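(* For any fixed $k\in\mathbb{N}=\{1,2,\dots\}$ and $\eta\in\mathbb{R}$, the function $\ell\mapsto\rho_{\ell,\eta,k}$ is increasing on the interval $(-1/2,\infty)$, that is, $$\frac{d\rho_{\ell,\eta,k}}{d\ell}>0\qquad\text{for all }\ell>-1/2.$$
   Context: For real $\eta$ and $\ell>-1/2$, the regular Coulomb wave function is, for $x>0$, $$F_{\ell,\eta}(x)=C_{\ell,\eta}\,x^{\ell+1}e^{-ix}\,{}_1F_1(\ell+1-i\eta,\,2\ell+2;\,2ix),\qquad C_{\ell,\eta}=\frac{2^{\ell}e^{-\pi\eta/2}|\Gamma(\ell+1+i\eta)|}{\Gamma(2\ell+2)},$$ where ${}_1F_1(a,b;z)=\sum_{k\ge0}\frac{(a)_k}{(b)_k}\frac{z^k}{k!}$ and $(a)_k=\Gamma(a+k)/\Gamma(a)$. It is real-valued for $x>0$ and solves $y''+\left(1-\frac{2\eta}{x}-\frac{\ell(\ell+1)}{x^2}\right)y=0$. The numbers $\rho_{\ell,\eta,1}<\rho_{\ell,\eta,2}<\cdots$ denote all the (infinitely many) positive zeros of $F_{\ell,\eta}$ in increasing order. *)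

theory Defs
  imports "HOL-Analysis.Analysis"
begin

definition hyp1F1 :: "complex \<Rightarrow> complex \<Rightarrow> complex \<Rightarrow> complex" where
  "hyp1F1 a b z = (\<Sum>k. pochhammer a k / pochhammer b k * (z ^ k / fact k))"

definition coulomb_C :: "real \<Rightarrow> real \<Rightarrow> real" where
  "coulomb_C l \<eta> =
     2 powr l * exp (- pi * \<eta> / 2)
       * cmod (Gamma (complex_of_real (l + 1) + \<i> * complex_of_real \<eta>)) / Gamma (2 * l + 2)"

text \<open>The defining formula is complex-valued; that its values are real for \<open>x > 0\<close> is a
  theorem (Kummer's transformation) and is not built into the definition.\<close>

definition coulomb_F :: "real \<Rightarrow> real \<Rightarrow> real \<Rightarrow> complex" where
  "coulomb_F l \<eta> x =
     complex_of_real (coulomb_C l \<eta>) * complex_of_real (x powr (l + 1))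
       * exp (- \<i> * complex_of_real x)
       * hyp1F1 (complex_of_real (l + 1) - \<i> * complex_of_real \<eta>)
           (complex_of_real (2 * l + 2)) (2 * \<i> * complex_of_real x)"

text \<open>The \<open>k\<close>-th positive zero in increasing order, counted from \<open>k = 1\<close>: the positive zero
  \<open>x\<close> for which exactly \<open>k\<close> positive zeros are at most \<open>x\<close>. Since \<open>card\<close> of an infinite
  set is \<open>0\<close>, for \<open>k \<ge> 1\<close> the condition also says that only finitely many zeros precede \<open>x\<close>.\<close>

definition coulomb_zero :: "real \<Rightarrow> real \<Rightarrow> nat \<Rightarrow> real" where
  "coulomb_zero l \<eta> k =
     (THE x. 0 < x \<and> coulomb_F l \<eta> x = 0 \<and> card {y. 0 < y \<and> y \<le> x \<and> coulomb_F l \<eta> y = 0} = k)"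

end

theory Submission
  imports Defs
begin

text \<open>
  Up to a positive factor $C x^{l+1}$ the Coulomb function is a real entire function
  $\varphi_l(x) = e^{-ix} {}_1F_1(l+1-i\eta, 2l+2; 2ix)$ with $\varphi_l(0) = 1$, so the positive
  zeros of \<^const>\<open>coulomb_F\<close> are those of $\varphi_l$. The Coulomb equation for
  $x^{l+1} \varphi_l$ becomes
  $x \varphi_l'' + 2 (l+1) \varphi_l' + (x - 2\eta) \varphi_l = 0$.

  The classical formula for the speed of a zero comes from differentiating the equation with respect
  to $l$. Here the derivative is replaced by a finite difference, which requires no
  differentiability in $l$. The Wronskian of the solutions for two parameters $l$ and $m$ has a
  derivative proportional to $l(l+1) - m(m+1) = (l-m)(l+m+1)$, and integration from $0$ gives
  \[ (l-m) \varphi_l \varphi_m + x (\varphi_l' \varphi_m - \varphi_l \varphi_m') = (l-m) J(l,m,x),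
     \quad J(l,m,x) = \int_0^1 \varphi_l(x v^s) \varphi_m(x v^s) \, dv, \quad s = 1/(l+m+1) \]
  (lemma \<open>coulomb_wronskian\<close>). The substitution by the power $v^s$ absorbs both the singular weight
  $t^{l+m}$ and the factor $l+m+1$, so that $J$ is visibly continuous in $(l,x)$, and
  $J(m,m,x) > 0$. Two consequences follow.

  If $\varphi_m$ and $\varphi_m'$ both vanished at $x$, then $J(l,m,x) = 0$ for every $l$ different from $m$ and,
  in the limit, $J(m,m,x) = 0$. Hence all zeros are simple (\<open>coulomb_zeros_simple\<close>). Simple zeros are
  isolated, and their number in an interval is stable under $C^1$-small perturbation
  (\<open>card_zeros_locally_constant\<close>). Since Sturm comparison with $\sin(x/2)$ provides infinitely many
  zeros (\<open>coulomb_phi_unbounded_zeros\<close>), the $k$-th zero $\rho(l)$ is well defined, and it depends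
  continuously on $l$ (\<open>tendsto_coulomb_zero\<close>).

  At $x = \rho(l)$ the identity reads
  $\rho(l) \varphi_l'(\rho(l)) \varphi_m(\rho(l)) = (l-m) J(l,m,\rho(l))$, where the factor
  $\varphi_m(\rho(l))$ is asymptotically $\varphi_m'(\rho(m)) (\rho(l) - \rho(m))$. Division by
  $l - m$ and $l \rightarrow m$ give
  \[ \rho'(m) = J(m,m,\rho(m)) / (\rho(m) \varphi_m'(\rho(m))^2) > 0. \]
\<close>

section \<open>The power series of the regular Coulomb function\<close>

text \<open>
  The recursion is the comparison of coefficients in
  $x \varphi'' + 2 (l+1) \varphi' + (x - 2\eta) \varphi = 0$, that is
  $n (n+2l+1) a_n = 2\eta a_{n-1} - a_{n-2}$, normalised by $a_0 = 1$.
\<close>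

fun coulomb_coeff :: "real \<Rightarrow> real \<Rightarrow> nat \<Rightarrow> real" where
  "coulomb_coeff \<eta> l 0 = 1"
| "coulomb_coeff \<eta> l (Suc 0) = \<eta> / (l + 1)"
| "coulomb_coeff \<eta> l (Suc (Suc n)) =
     (2 * \<eta> * coulomb_coeff \<eta> l (Suc n) - coulomb_coeff \<eta> l n)
       / (real (n + 2) * (real (n + 2) + 2 * l + 1))"

text \<open>
  For $l > -1/2$ the factor $n (n+2l+1)$ in the recursion is at least $n^2$. This makes the bound
  uniform in $l$, so that the power series converges uniformly in $l$ as well as locally uniformly
  in $x$.
\<close>

lemma coulomb_coeff_bound:
  assumes l: "l > -1/2"
  shows "\<bar>coulomb_coeff \<eta> l n\<bar> \<le> (2 * \<bar>\<eta>\<bar> + 1) ^ n / fact n"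
proof (induction n rule: less_induct)
  case (less n)
  define B where "B = 2 * \<bar>\<eta>\<bar> + 1"
  have B: "B \<ge> 1" by (simp add: B_def)
  consider "n = 0" | "n = 1" | j where "n = Suc (Suc j)"
    by (metis One_nat_def not0_implies_Suc)
  then show ?case
  proof cases
    case 2
    have "\<bar>\<eta>\<bar> \<le> (2 * \<bar>\<eta>\<bar> + 1) * (1/2)" by simp
    also have "\<dots> \<le> (2 * \<bar>\<eta>\<bar> + 1) * (l + 1)"
      using l by (intro mult_left_mono) auto
    finally have "\<bar>\<eta>\<bar> / (l + 1) \<le> 2 * \<bar>\<eta>\<bar> + 1"
      using l by (subst pos_divide_le_eq) auto
    with 2 l show ?thesis by simp
  next
    case (3 j)
    let ?c = "coulomb_coeff \<eta> l"
    have c1: "\<bar>?c (Suc j)\<bar> \<le> B ^ Suc j / fact (Suc j)" and c0: "\<bar>?c j\<bar> \<le> B ^ j / fact j"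
      using less.IH[of "Suc j"] less.IH[of j] 3 by (auto simp: B_def)
    have den: "real (j+2) * real (j+2) \<le> real (j + 2) * (real (j + 2) + 2 * l + 1)"
      using l by (intro mult_left_mono) auto
    have den0: "0 < real (j+2) * real (j+2)" by simp
    have "\<bar>?c n\<bar> = \<bar>2 * \<eta> * ?c (Suc j) - ?c j\<bar> / (real (j + 2) * (real (j + 2) + 2 * l + 1))"
      using den den0 3 by (simp add: abs_divide abs_mult)
    also have "\<dots> \<le> \<bar>2 * \<eta> * ?c (Suc j) - ?c j\<bar> / (real (j+2) * real (j+2))"
      using den den0 by (intro divide_left_mono) auto
    also have "\<bar>2 * \<eta> * ?c (Suc j) - ?c j\<bar> \<le> 2 * \<bar>\<eta>\<bar> * \<bar>?c (Suc j)\<bar> + \<bar>?c j\<bar>"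
      by (metis abs_mult abs_numeral abs_triangle_ineq4)
    also have "\<dots> \<le> 2 * \<bar>\<eta>\<bar> * (B ^ Suc j / fact (Suc j)) + B ^ j / fact j"
      using c1 c0 by (intro add_mono mult_left_mono) auto
    also have "\<dots> \<le> 2 * \<bar>\<eta>\<bar> * (real (j+2) * B ^ Suc j / fact (Suc j))
                      + real (j+2) * B ^ Suc j / fact (Suc j)"
    proof (intro add_mono mult_left_mono)
      have "1 * B ^ Suc j \<le> real (j+2) * B ^ Suc j" 
        using B by (intro mult_right_mono) auto
      then show "B ^ Suc j / fact (Suc j) \<le> real (j+2) * B ^ Suc j / fact (Suc j)"
        by (intro divide_right_mono) auto
      have "B ^ j / fact j = real (j+1) * B ^ j / fact (Suc j)"
        by (simp add: fact_Suc del: of_nat_Suc)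
      also have "\<dots> \<le> real (j+2) * B ^ Suc j / fact (Suc j)"
        using B by (intro divide_right_mono mult_mono power_increasing) auto
      finally show "B ^ j / fact j \<le> real (j+2) * B ^ Suc j / fact (Suc j)" .
    qed auto
    also have "\<dots> = real (j+2) * B ^ Suc (Suc j) / fact (Suc j)"
    proof -
      have *: "2 * \<bar>\<eta>\<bar> * C + C = B * C" for C by (simp add: B_def algebra_simps)
      show ?thesis by (subst *) simp
    qed
    also have "\<dots> / (real (j+2) * real (j+2)) = B ^ n / fact n"
    proof -
      have "fact n = real (j+2) * fact (Suc j)" unfolding 3 by (simp add: fact_Suc[of "Suc j"])
      then show ?thesis unfolding 3 by (simp del: fact_Suc)
    qed
    finally show ?thesis
      by (simp add: B_def divide_right_mono)
  qed auto
qed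

lemma coulomb_coeff_rec:
  assumes l: "l > -1/2"
  shows "real (n+1) * (real n + 2 * l + 2) * coulomb_coeff \<eta> l (n + 1)
           = 2 * \<eta> * coulomb_coeff \<eta> l n - (if n = 0 then 0 else coulomb_coeff \<eta> l (n - 1))"
proof (cases n)
  case 0 with l show ?thesis by (simp add: field_simps)
next
  case (Suc j)
  have nz: "real (j + 2) * (real (j + 2) + 2 * l + 1) \<noteq> 0" using l by auto
  have "(real (j + 2) * (real (j + 2) + 2 * l + 1)) * coulomb_coeff \<eta> l (Suc (Suc j))
     = 2 * \<eta> * coulomb_coeff \<eta> l (Suc j) - coulomb_coeff \<eta> l j"
    unfolding coulomb_coeff.simps(3) using nz by (subst times_divide_eq_right, subst nonzero_mult_div_cancel_left) auto
  with Suc show ?thesis by (simp add: algebra_simps)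
qed

lemma summable_coulomb_coeff_norm:
  assumes l: "l > -1/2"
  shows "summable (\<lambda>n. norm (coulomb_coeff \<eta> l n * x ^ n))"
proof (rule summable_comparison_test')
  show "summable (\<lambda>n. ((2 * \<bar>\<eta>\<bar> + 1) * \<bar>x\<bar>) ^ n /\<^sub>R fact n)"
    by (rule summable_exp_generic)
  show "norm (norm (coulomb_coeff \<eta> l n * x ^ n)) \<le> ((2 * \<bar>\<eta>\<bar> + 1) * \<bar>x\<bar>) ^ n /\<^sub>R fact n"
    if "n \<ge> 0" for n
    using mult_right_mono[OF coulomb_coeff_bound[OF l, of \<eta> n], of "\<bar>x\<bar> ^ n"]
    by (simp add: abs_mult power_abs power_mult_distrib divide_inverse mult_ac)
qed

text \<open>
  This is $e^{-ix} {}_1F_1(l+1-i\eta, 2l+2; 2ix)$ (see \<open>coulomb_kummer\<close> below), in a form that is real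
  by construction.
\<close>

definition coulomb_phi :: "real \<Rightarrow> real \<Rightarrow> real \<Rightarrow> real" where
  "coulomb_phi \<eta> l x = (\<Sum>n. coulomb_coeff \<eta> l n * x ^ n)"

definition coulomb_dphi :: "real \<Rightarrow> real \<Rightarrow> real \<Rightarrow> real" where
  "coulomb_dphi \<eta> l x = (\<Sum>n. diffs (coulomb_coeff \<eta> l) n * x ^ n)"

lemma coulomb_phi_0: "coulomb_phi \<eta> l 0 = 1"
  by (simp add: coulomb_phi_def)

lemma summable_coulomb_coeff:
  "l > -1/2 \<Longrightarrow> summable (\<lambda>n. coulomb_coeff \<eta> l n * x ^ n)"
  by (rule summable_norm_cancel[OF summable_coulomb_coeff_norm])

lemma summable_diffs_coulomb_coeff:
  assumes "l > -1/2"
  shows "summable (\<lambda>n. diffs (coulomb_coeff \<eta> l) n * x ^ n)"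
  by (rule termdiff_converges_all) (rule summable_coulomb_coeff[OF assms])

lemma has_real_derivative_coulomb_phi [derivative_intros]:
  assumes "(g has_real_derivative g') (at x within A)" "l > -1/2"
  shows "((\<lambda>x. coulomb_phi \<eta> l (g x)) has_real_derivative coulomb_dphi \<eta> l (g x) * g') (at x within A)"
proof (rule DERIV_chain2[OF _ assms(1)])
  show "(coulomb_phi \<eta> l has_real_derivative coulomb_dphi \<eta> l (g x)) (at (g x))"
  unfolding coulomb_phi_def[abs_def] coulomb_dphi_def
    by (rule termdiffs_strong_converges_everywhere) (rule summable_coulomb_coeff[OF assms(2)])
qed

text \<open>
  The second derivative is left existential: only its value from the equation is ever used.
\<close>

lemma coulomb_ode:
  assumes l: "l > -1/2"
  obtains d where "(coulomb_dphi \<eta> l has_real_derivative d) (at x)"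
    and "x * d + 2 * (l + 1) * coulomb_dphi \<eta> l x + (x - 2 * \<eta>) * coulomb_phi \<eta> l x = 0"
proof -
  let ?c = "coulomb_coeff \<eta> l"
  define d where "d = (\<Sum>n. diffs (diffs ?c) n * x ^ n)"
  have der: "(coulomb_dphi \<eta> l has_real_derivative d) (at x)"
    unfolding coulomb_dphi_def[abs_def] d_def
    by (rule termdiffs_strong_converges_everywhere) (rule summable_diffs_coulomb_coeff[OF l])
  have shift: "(\<lambda>n. (if n = 0 then 0 else c (n - 1)) * x ^ n) sums (x * (\<Sum>n. c n * x ^ n))"
    if "summable (\<lambda>n. c n * x ^ n)" for c :: "nat \<Rightarrow> real"
  proof -
    have "(\<lambda>n. x * (c n * x ^ n)) sums (x * (\<Sum>n. c n * x ^ n))"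
      by (intro sums_mult summable_sums that)
    then have "(\<lambda>n. (if Suc n = 0 then 0 else c (Suc n - 1)) * x ^ Suc n) sums (x * (\<Sum>n. c n * x ^ n))"
      by (simp add: mult_ac)
    then show ?thesis by (subst (asm) sums_Suc_iff) simp
  qed
  have 1: "(\<lambda>n. (if n = 0 then 0 else diffs (diffs ?c) (n - 1)) * x ^ n) sums (x * d)"
    unfolding d_def by (intro shift termdiff_converges_all summable_diffs_coulomb_coeff[OF l])
  have 2: "(\<lambda>n. (if n = 0 then 0 else ?c (n - 1)) * x ^ n) sums (x * coulomb_phi \<eta> l x)"
    unfolding coulomb_phi_def by (intro shift summable_coulomb_coeff[OF l])
  have 3: "(\<lambda>n. 2 * (l + 1) * (diffs ?c n * x ^ n)) sums (2 * (l + 1) * coulomb_dphi \<eta> l x)"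
    unfolding coulomb_dphi_def by (intro sums_mult summable_sums summable_diffs_coulomb_coeff[OF l])
  have 4: "(\<lambda>n. 2 * \<eta> * (?c n * x ^ n)) sums (2 * \<eta> * coulomb_phi \<eta> l x)"
    unfolding coulomb_phi_def by (intro sums_mult summable_sums summable_coulomb_coeff[OF l])
  have coeff: "(if n = 0 then 0 else diffs (diffs ?c) (n - 1)) + 2 * (l + 1) * diffs ?c n
      + (if n = 0 then 0 else ?c (n - 1)) - 2 * \<eta> * ?c n = 0" for n
  proof (cases n)
    case 0 then show ?thesis using coulomb_coeff_rec[OF l, of 0 \<eta>] l by (simp add: diffs_def field_simps)
  next
    case (Suc j)
    then show ?thesis using coulomb_coeff_rec[OF l, of n \<eta>] 
      by (simp add: diffs_def del: coulomb_coeff.simps) (simp add: algebra_simps del: coulomb_coeff.simps)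
  qed
  have "(\<lambda>n. ((if n = 0 then 0 else diffs (diffs ?c) (n - 1)) + 2 * (l + 1) * diffs ?c n
      + (if n = 0 then 0 else ?c (n - 1)) - 2 * \<eta> * ?c n) * x ^ n) sums
      (x * d + 2 * (l + 1) * coulomb_dphi \<eta> l x + x * coulomb_phi \<eta> l x - 2 * \<eta> * coulomb_phi \<eta> l x)"
    using sums_diff[OF sums_add[OF sums_add[OF 1 3] 2] 4] by (simp only: distrib_right left_diff_distrib mult.assoc)
  then have "x * d + 2 * (l + 1) * coulomb_dphi \<eta> l x + x * coulomb_phi \<eta> l x - 2 * \<eta> * coulomb_phi \<eta> l x = 0"
    unfolding coeff by (auto dest: sums_unique2[OF sums_zero])
  then show thesis by (intro that[OF der]) (simp add: algebra_simps)
qed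

text \<open>
  On each disc of radius $R$ the terms are dominated by those of the series of $M e^{BR}$, uniformly in the
  parameter, and continuity is a local property.
\<close>

lemma continuous_on_power_series_parameter:
  fixes c :: "nat \<Rightarrow> real \<Rightarrow> real"
  assumes cont: "\<And>n. continuous_on S (c n)"
    and bound: "\<And>n l. l \<in> S \<Longrightarrow> \<bar>c n l\<bar> \<le> M * B ^ n / fact n" and "B \<ge> 0"
  shows "continuous_on (S \<times> UNIV) (\<lambda>(l, x). \<Sum>n. c n l * x ^ n)"
proof -
  have *: "continuous_on (S \<times> ball 0 R) (\<lambda>(l, x). \<Sum>n. c n l * x ^ n)" for R :: real
  proof (rule uniform_limit_theorem[OF _ _ trivial_limit_sequentially])
    show "uniform_limit (S \<times> ball 0 R) (\<lambda>N p. \<Sum>n<N. (case p of (l, x) \<Rightarrow> c n l * x ^ n))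
        (\<lambda>(l, x). \<Sum>n. c n l * x ^ n) sequentially"
    proof -
      have "uniform_limit (S \<times> ball 0 R) (\<lambda>N p. \<Sum>n<N. (case p of (l, x) \<Rightarrow> c n l * x ^ n))
        (\<lambda>p. \<Sum>n. (case p of (l, x) \<Rightarrow> c n l * x ^ n)) sequentially"
      proof (rule Weierstrass_m_test)
        show "summable (\<lambda>n. M * ((B * R) ^ n /\<^sub>R fact n))"
          by (intro summable_mult summable_exp_generic)
        fix n and p :: "real \<times> real" assume "p \<in> S \<times> ball 0 R"
        then obtain l x where p: "p = (l, x)" "l \<in> S" "\<bar>x\<bar> \<le> R" by (cases p) auto
        have "\<bar>c n l\<bar> * \<bar>x\<bar> ^ n \<le> (M * B ^ n / fact n) * R ^ n"
          using bound[OF p(2), of n] p(3) by (intro mult_mono power_mono) (auto intro: order_trans[OF abs_ge_zero])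
        then show "norm (case p of (l, x) \<Rightarrow> c n l * x ^ n) \<le> M * ((B * R) ^ n /\<^sub>R fact n)"
          by (simp add: p(1) abs_mult power_abs power_mult_distrib field_simps)
      qed
      then show ?thesis by (simp add: case_prod_unfold)
    qed
    have "continuous_on (S \<times> ball 0 R) (\<lambda>p. c n (fst p) * snd p ^ n)" for n
      by (intro continuous_intros continuous_on_compose2[OF cont]) auto
    then show "\<forall>\<^sub>F N in sequentially. continuous_on (S \<times> ball 0 R) (\<lambda>p. \<Sum>n<N. (case p of (l, x) \<Rightarrow> c n l * x ^ n))"
      by (intro always_eventually allI continuous_on_sum) (simp add: case_prod_unfold)
  qed
  show ?thesis
    unfolding continuous_on_def
  proof
    fix p :: "real \<times> real" assume p: "p \<in> S \<times> UNIV"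
    define R where "R = \<bar>snd p\<bar> + 1"
    have "p \<in> S \<times> ball 0 R" using p by (auto simp: R_def)
    with *[of R] have "((\<lambda>(l, x). \<Sum>n. c n l * x ^ n) \<longlongrightarrow> (\<lambda>(l, x). \<Sum>n. c n l * x ^ n) p) (at p within S \<times> ball 0 R)"
      unfolding continuous_on_def by blast
    moreover have "at p within S \<times> ball 0 R = at p within S \<times> UNIV"
      by (rule at_within_nhd[of p "UNIV \<times> ball 0 R"]) (use p in \<open>auto simp: R_def open_Times\<close>)
    ultimately show "((\<lambda>(l, x). \<Sum>n. c n l * x ^ n) \<longlongrightarrow> (\<lambda>(l, x). \<Sum>n. c n l * x ^ n) p) (at p within S \<times> UNIV)"
      by simp
  qed
qed

lemma continuous_on_coulomb_coeff: "continuous_on {-1/2<..} (\<lambda>l. coulomb_coeff \<eta> l n)"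
proof (induction n rule: less_induct)
  case (less n)
  consider "n = 0" | "n = 1" | j where "n = Suc (Suc j)"
    by (metis One_nat_def not0_implies_Suc)
  then show ?case
  proof cases
    case 3
    have nz: "real (j + 2) * (real (j + 2) + 2 * l + 1) \<noteq> 0" if "l > -1/2" for l
      using that by auto
    show ?thesis
      unfolding 3 coulomb_coeff.simps(3)
      using nz by (intro continuous_intros less.IH) (auto simp: 3)
  qed (auto intro!: continuous_intros)
qed

lemma continuous_on_coulomb_phi:
  "continuous_on ({-1/2<..} \<times> UNIV) (\<lambda>(l, x). coulomb_phi \<eta> l x)"
  unfolding coulomb_phi_def
proof (rule continuous_on_power_series_parameter)
  show "continuous_on {-1/2<..} (\<lambda>l. coulomb_coeff \<eta> l n)" for n
    by (rule continuous_on_coulomb_coeff)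
  show "\<bar>coulomb_coeff \<eta> l n\<bar> \<le> 1 * (2 * \<bar>\<eta>\<bar> + 1) ^ n / fact n" if "l \<in> {-1/2<..}" for n l
    using coulomb_coeff_bound[of l \<eta> n] that by simp
qed auto

lemma continuous_on_coulomb_dphi:
  "continuous_on ({-1/2<..} \<times> UNIV) (\<lambda>(l, x). coulomb_dphi \<eta> l x)"
  unfolding coulomb_dphi_def
proof (rule continuous_on_power_series_parameter)
  show "continuous_on {-1/2<..} (\<lambda>l. diffs (coulomb_coeff \<eta> l) n)" for n
    unfolding diffs_def by (intro continuous_intros continuous_on_coulomb_coeff)
  show "\<bar>diffs (coulomb_coeff \<eta> l) n\<bar> \<le> (2 * \<bar>\<eta>\<bar> + 1) * (2 * \<bar>\<eta>\<bar> + 1) ^ n / fact n"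
    if "l \<in> {-1/2<..}" for n l
    using mult_left_mono[OF coulomb_coeff_bound[of l \<eta> "Suc n"], of "real (Suc n)"] that 
    by (simp add: diffs_def abs_mult del: coulomb_coeff.simps of_nat_Suc)
qed auto

section \<open>Reduction to the real power series\<close>

text \<open>
  With $P$ the formal series with coefficients \<^const>\<open>coulomb_coeff\<close>, the equation for $P$ turns into Kummer's
  equation for $M = e^{iX} P$. Unlike the equation for $P$, Kummer's is a recursion of order one for the
  coefficients, and its solution is a quotient of Pochhammer symbols.
\<close>

lemma kummer_coeff:
  assumes l: "l > -1/2"
  shows "fps_nth (fps_exp \<i> * Abs_fps (\<lambda>n. complex_of_real (coulomb_coeff \<eta> l n))) n
    = pochhammer (complex_of_real (l + 1) - \<i> * complex_of_real \<eta>) n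
        / pochhammer (complex_of_real (2 * l + 2)) n * ((2 * \<i>) ^ n / fact n)"
proof -
  define P where "P = Abs_fps (\<lambda>n. complex_of_real (coulomb_coeff \<eta> l n))"
  define E :: "complex fps" where "E = fps_exp \<i>"
  define M where "M = E * P"
  define a where "a = complex_of_real (l + 1) - \<i> * complex_of_real \<eta>"
  define b where "b = complex_of_real (2 * l + 2)"
  define h where "h = complex_of_real (2 * \<eta>)"
  define c where "c = fps_const \<i>"
  \<comment> \<open>Comparing coefficients, this is the recursion of the real series.\<close>
  have P_ode: "fps_X * fps_deriv (fps_deriv P) + fps_const b * fps_deriv P + (fps_X - fps_const h) * P = 0"
  proof (rule fps_ext)
    fix n
    have "complex_of_real (real (n+1) * (real n + 2 * l + 2) * coulomb_coeff \<eta> l (n + 1))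
           = complex_of_real (2 * \<eta> * coulomb_coeff \<eta> l n - (if n = 0 then 0 else coulomb_coeff \<eta> l (n - 1)))"
      using coulomb_coeff_rec[OF l, of n \<eta>] by (rule arg_cong)
    then show "fps_nth (fps_X * fps_deriv (fps_deriv P) + fps_const b * fps_deriv P + (fps_X - fps_const h) * P) n
        = fps_nth 0 n"
      by (cases n) (simp_all add: P_def b_def h_def fps_X_mult_nth left_diff_distrib del: coulomb_coeff.simps,
        simp_all add: algebra_simps del: coulomb_coeff.simps)
  qed
  have E': "fps_deriv E = c * E" by (simp add: E_def c_def)
  have c2: "c * c = -1" by (simp add: c_def flip: fps_const_neg)
  have M': "fps_deriv M = c * M + E * fps_deriv P"
    by (simp add: M_def E' algebra_simps)
  have M'': "fps_deriv (fps_deriv M) = c * fps_deriv M + c * (E * fps_deriv P) + E * fps_deriv (fps_deriv P)"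
    by (subst M') (simp add: E' c_def algebra_simps)
  have "fps_X * fps_deriv (fps_deriv M)
      = 2 * c * fps_X * fps_deriv M - fps_const b * fps_deriv M + (c * fps_const b + fps_const h) * M"
    using P_ode c2 M' M'' M_def by algebra
  moreover have "2 * c * fps_X * fps_deriv M = fps_const (2 * \<i>) * (fps_X * fps_deriv M)"
    by (simp add: c_def numeral_fps_const flip: fps_const_mult)
  moreover have "c * fps_const b + fps_const h = fps_const (2 * \<i> * a)"
    by (simp add: c_def a_def b_def h_def algebra_simps)
  ultimately have M_ode: "fps_X * fps_deriv (fps_deriv M)
      = fps_const (2 * \<i>) * (fps_X * fps_deriv M) - fps_const b * fps_deriv M + fps_const (2 * \<i> * a) * M"
    by simp
  have rec: "fps_nth M (Suc n) * ((of_nat n + 1) * (b + of_nat n)) = fps_nth M n * (2 * \<i> * (a + of_nat n))" for n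
    using arg_cong[OF M_ode, of "\<lambda>f. fps_nth f n"]
    by (cases n) (simp_all add: fps_X_mult_nth algebra_simps)
  have b_nz: "b + of_nat n \<noteq> 0" for n
  proof
    assume "b + of_nat n = 0"
    then have "Re (b + of_nat n) = 0" by simp
    with l show False by (simp add: b_def)
  qed
  have "fps_nth M n = pochhammer a n / pochhammer b n * ((2 * \<i>) ^ n / fact n)"
  proof (induction n)
    case 0
    show ?case by (simp add: M_def E_def P_def)
  next
    case (Suc n)
    have n1: "(of_nat n + 1 :: complex) \<noteq> 0" by (metis of_nat_Suc of_nat_neq_0 add.commute)
    have "fps_nth M (Suc n) = fps_nth M n * (2 * \<i> * (a + of_nat n)) / ((of_nat n + 1) * (b + of_nat n))"
      using rec[of n] n1 b_nz[of n] by (simp add: nonzero_eq_divide_eq)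
    also have "\<dots> = pochhammer a (Suc n) / pochhammer b (Suc n) * ((2 * \<i>) ^ Suc n / fact (Suc n))"
      unfolding Suc.IH pochhammer_Suc fact_Suc power_Suc by (simp add: add.commute mult_ac)
    finally show ?case .
  qed
  then show ?thesis by (simp only: M_def E_def P_def a_def b_def)
qed

text \<open>
  The function ${}_1F_1$ is the Cauchy product of $e^{ix}$ and the real series. In particular the Coulomb
  function is real-valued.
\<close>

lemma coulomb_kummer:
  assumes l: "l > -1/2"
  shows "exp (- \<i> * complex_of_real x) * hyp1F1 (complex_of_real (l + 1) - \<i> * complex_of_real \<eta>)
           (complex_of_real (2 * l + 2)) (2 * \<i> * complex_of_real x) = complex_of_real (coulomb_phi \<eta> l x)"
proof -
  let ?e = "\<lambda>k. (\<i> * complex_of_real x) ^ k /\<^sub>R fact k"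
  let ?p = "\<lambda>k. complex_of_real (coulomb_coeff \<eta> l k * x ^ k)"
  have phi: "(\<Sum>k. ?p k) = complex_of_real (coulomb_phi \<eta> l x)"
    unfolding coulomb_phi_def by (rule suminf_of_real[symmetric]) (rule summable_coulomb_coeff[OF l])
  have "(\<lambda>k. \<Sum>i\<le>k. ?e i * ?p (k - i)) sums ((\<Sum>k. ?e k) * (\<Sum>k. ?p k))"
  proof (rule Cauchy_product_sums)
    show "summable (\<lambda>k. norm (?e k))" by (rule summable_norm_exp)
    show "summable (\<lambda>k. norm (?p k))"
      using summable_coulomb_coeff_norm[OF l, of \<eta> x] by (simp only: norm_of_real real_norm_def)
  qed
  moreover have "(\<Sum>i\<le>k. ?e i * ?p (k - i)) = pochhammer (complex_of_real (l + 1) - \<i> * complex_of_real \<eta>) k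
        / pochhammer (complex_of_real (2 * l + 2)) k * ((2 * \<i> * complex_of_real x) ^ k / fact k)" (is "_ = ?k k") for k
  proof -
    have "?e i * ?p (k - i) = (\<i> ^ i / fact i * complex_of_real (coulomb_coeff \<eta> l (k - i))) * complex_of_real x ^ k"
      if "i \<le> k" for i
    proof -
      have "complex_of_real x ^ k = complex_of_real x ^ i * complex_of_real x ^ (k - i)"
        using that by (simp flip: power_add)
      then show ?thesis by (simp add: scaleR_conv_of_real power_mult_distrib divide_inverse mult_ac)
    qed
    then have "(\<Sum>i\<le>k. ?e i * ?p (k - i)) = 
       (\<Sum>i\<le>k. \<i> ^ i / fact i * complex_of_real (coulomb_coeff \<eta> l (k - i))) * complex_of_real x ^ k"
      by (simp add: sum_distrib_right)
    also have "(\<Sum>i\<le>k. \<i> ^ i / fact i * complex_of_real (coulomb_coeff \<eta> l (k - i)))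
       = fps_nth (fps_exp \<i> * Abs_fps (\<lambda>n. complex_of_real (coulomb_coeff \<eta> l n))) k"
      by (simp add: fps_mult_nth atLeast0AtMost)
    finally show ?thesis unfolding kummer_coeff[OF l] by (simp add: power_mult_distrib)
  qed
  ultimately have "?k sums (exp (\<i> * complex_of_real x) * complex_of_real (coulomb_phi \<eta> l x))"
    by (simp only: phi exp_def)
  then have "hyp1F1 (complex_of_real (l + 1) - \<i> * complex_of_real \<eta>)
           (complex_of_real (2 * l + 2)) (2 * \<i> * complex_of_real x)
     = exp (\<i> * complex_of_real x) * complex_of_real (coulomb_phi \<eta> l x)"
    unfolding hyp1F1_def by (rule sums_unique[symmetric])
  then show ?thesis by (simp add: mult.assoc[symmetric] flip: exp_add)
qed

lemma coulomb_C_pos: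
  assumes l: "l > -1/2"
  shows "coulomb_C l \<eta> > 0"
proof -
  have "Gamma (complex_of_real (l + 1) + \<i> * complex_of_real \<eta>) \<noteq> 0"
  proof
    assume "Gamma (complex_of_real (l + 1) + \<i> * complex_of_real \<eta>) = 0"
    then have "Re (complex_of_real (l + 1) + \<i> * complex_of_real \<eta>) \<le> 0"
      unfolding Gamma_eq_zero_iff by (elim nonpos_Ints_cases) (simp only:, simp)
    with l show False by simp
  qed
  with l show ?thesis unfolding coulomb_C_def
    by (intro divide_pos_pos mult_pos_pos Gamma_real_pos) auto
qed

lemma coulomb_F_eq_0_iff:
  assumes l: "l > -1/2" and x: "x > 0"
  shows "coulomb_F l \<eta> x = 0 \<longleftrightarrow> coulomb_phi \<eta> l x = 0"
proof -
  have "coulomb_F l \<eta> x = complex_of_real (coulomb_C l \<eta> * x powr (l + 1)) * complex_of_real (coulomb_phi \<eta> l x)"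
    unfolding coulomb_F_def coulomb_kummer[OF l, symmetric] by (simp add: mult_ac)
  with coulomb_C_pos[OF l, of \<eta>] x show ?thesis by simp
qed

section \<open>The Wronskian identity for two parameters\<close>

text \<open>
  After the substitution $t = x v^{1/(l+m+1)}$ this is
  $\frac{l+m+1}{x^{l+m+1}} \int_0^x t^{l+m} \varphi_l(t) \varphi_m(t) \, dt$ for $x > 0$. The integrand in $v$ is
  continuous up to $v = 0$ and jointly continuous in all variables, even where $t^{l+m}$ is unbounded.
\<close>

definition coulomb_overlap :: "real \<Rightarrow> real \<Rightarrow> real \<Rightarrow> real \<Rightarrow> real" where
  "coulomb_overlap \<eta> m l x = integral {0..1}
     (\<lambda>v. coulomb_phi \<eta> l (x * v powr (1 / (l + m + 1))) * coulomb_phi \<eta> m (x * v powr (1 / (l + m + 1))))"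

lemma isCont_coulomb_phi:
  assumes "l > -1/2" shows "isCont (coulomb_phi \<eta> l) x"
  using has_real_derivative_coulomb_phi[OF DERIV_ident assms] by (rule DERIV_isCont)

text \<open>
  Let $K$ be the left-hand side. The two differential equations give
  $t K'(t) = (l+m+1) ((l-m) \varphi_l(t) \varphi_m(t) - K(t))$, so that $v \mapsto v K(x v^s)$ with $s = 1/(l+m+1)$
  has the derivative $(l-m) \varphi_l(x v^s) \varphi_m(x v^s)$. Integration over $[0,1]$ is the claim.
\<close>

lemma coulomb_wronskian:
  assumes l: "l > -1/2" and m: "m > -1/2"
  shows "(l - m) * coulomb_phi \<eta> l x * coulomb_phi \<eta> m x
      + x * (coulomb_dphi \<eta> l x * coulomb_phi \<eta> m x - coulomb_phi \<eta> l x * coulomb_dphi \<eta> m x)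
    = (l - m) * coulomb_overlap \<eta> m l x"
proof -
  define s where "s = 1 / (l + m + 1)"
  have s: "s > 0" "s * (l + m + 1) = 1" using l m by (auto simp: s_def)
  define K where "K = (\<lambda>t. (l - m) * coulomb_phi \<eta> l t * coulomb_phi \<eta> m t
      + t * (coulomb_dphi \<eta> l t * coulomb_phi \<eta> m t - coulomb_phi \<eta> l t * coulomb_dphi \<eta> m t))"
  \<comment> \<open>$t^{l+m+1} K(t)$ is the Wronskian of the solutions $t^{l+1} \varphi_l$ and $t^{m+1} \varphi_m$;
    this is the equation for its derivative, freed of the power of $t$.\<close>
  have K': "\<exists>k. (K has_real_derivative k) (at t) \<and>
      t * k = (l + m + 1) * ((l - m) * coulomb_phi \<eta> l t * coulomb_phi \<eta> m t - K t)" for t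
  proof -
    obtain d where d: "(coulomb_dphi \<eta> l has_real_derivative d) (at t)"
      and ode_l: "t * d + 2 * (l + 1) * coulomb_dphi \<eta> l t + (t - 2 * \<eta>) * coulomb_phi \<eta> l t = 0"
      using coulomb_ode[OF l] by blast
    obtain e where e: "(coulomb_dphi \<eta> m has_real_derivative e) (at t)"
      and ode_m: "t * e + 2 * (m + 1) * coulomb_dphi \<eta> m t + (t - 2 * \<eta>) * coulomb_phi \<eta> m t = 0"
      using coulomb_ode[OF m] by blast
    show ?thesis
    proof (intro exI conjI)
      show "(K has_real_derivative ((l - m) * coulomb_dphi \<eta> l t * coulomb_phi \<eta> m t
          + (l - m) * coulomb_phi \<eta> l t * coulomb_dphi \<eta> m t
          + (coulomb_dphi \<eta> l t * coulomb_phi \<eta> m t - coulomb_phi \<eta> l t * coulomb_dphi \<eta> m t)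
          + t * (d * coulomb_phi \<eta> m t - coulomb_phi \<eta> l t * e))) (at t)"
        unfolding K_def
        by (rule derivative_eq_intros d e l m refl | simp)+
      show "t * ((l - m) * coulomb_dphi \<eta> l t * coulomb_phi \<eta> m t
          + (l - m) * coulomb_phi \<eta> l t * coulomb_dphi \<eta> m t
          + (coulomb_dphi \<eta> l t * coulomb_phi \<eta> m t - coulomb_phi \<eta> l t * coulomb_dphi \<eta> m t)
          + t * (d * coulomb_phi \<eta> m t - coulomb_phi \<eta> l t * e))
        = (l + m + 1) * ((l - m) * coulomb_phi \<eta> l t * coulomb_phi \<eta> m t - K t)"
      proof -
        have td: "t * d = - (2 * (l + 1) * coulomb_dphi \<eta> l t + (t - 2 * \<eta>) * coulomb_phi \<eta> l t)"
          and te: "t * e = - (2 * (m + 1) * coulomb_dphi \<eta> m t + (t - 2 * \<eta>) * coulomb_phi \<eta> m t)"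
          using ode_l ode_m by linarith+
        have "t * (d * coulomb_phi \<eta> m t - coulomb_phi \<eta> l t * e)
            = (t * d) * coulomb_phi \<eta> m t - coulomb_phi \<eta> l t * (t * e)"
          by (simp add: algebra_simps)
        also have "\<dots> = 2 * (m + 1) * coulomb_phi \<eta> l t * coulomb_dphi \<eta> m t
            - 2 * (l + 1) * coulomb_dphi \<eta> l t * coulomb_phi \<eta> m t"
          unfolding td te by (simp add: algebra_simps)
        finally show ?thesis unfolding K_def by (simp only:) (simp add: algebra_simps)
      qed
    qed
  qed
  have contK: "isCont K t" for t
  proof -
    from K'[of t] obtain k where "(K has_real_derivative k) (at t)" by (elim exE conjE)
    then show ?thesis by (rule DERIV_isCont)
  qed
  let ?g = "\<lambda>v. (l - m) * (coulomb_phi \<eta> l (x * v powr s) * coulomb_phi \<eta> m (x * v powr s))"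
  have "(?g has_integral (1 * K (x * 1 powr s) - 0 * K (x * 0 powr s))) {0..1}"
  proof (rule fundamental_theorem_of_calculus_interior)
    show "continuous_on {0..1} (\<lambda>v. v * K (x * v powr s))"
    proof -
      have "continuous_on UNIV K" using contK by (simp add: continuous_at_imp_continuous_on)
      moreover have "continuous_on {0..1} (\<lambda>v::real. x * v powr s)"
        using s by (intro continuous_on_powr' continuous_intros) auto
      ultimately have "continuous_on {0..1} (\<lambda>v. K (x * v powr s))"
        by (rule continuous_on_compose2) simp
      then show ?thesis by (intro continuous_on_mult continuous_on_id)
    qed
    fix v :: real assume v: "v \<in> {0<..<1}"
    define t where "t = x * v powr s"
    obtain k where k: "(K has_real_derivative k) (at t)"
      and tk: "t * k = (l + m + 1) * ((l - m) * coulomb_phi \<eta> l t * coulomb_phi \<eta> m t - K t)"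
      using K'[of t] by (elim exE conjE)
    have pw: "v * v powr (s - 1) = v powr s" using v by (simp add: powr_diff)
    have dt: "((\<lambda>v. x * v powr s) has_real_derivative x * (s * v powr (s - 1))) (at v)"
      using v by (auto intro!: derivative_eq_intros)
    have "((\<lambda>v. v * K (x * v powr s)) has_real_derivative
       (1 * K (x * v powr s) + (k * (x * (s * v powr (s - 1)))) * v)) (at v)"
      by (intro DERIV_mult DERIV_ident DERIV_chain2[OF _ dt]) (use k in \<open>simp add: t_def\<close>)
    also have "(1 * K (x * v powr s) + (k * (x * (s * v powr (s - 1)))) * v) = K t + s * (t * k)"
      by (simp add: t_def pw[symmetric])
    also have "\<dots> = ?g v"
      unfolding tk using s(2) by (simp add: t_def mult.assoc[symmetric])
    finally show "((\<lambda>v. v * K (x * v powr s)) has_vector_derivative ?g v) (at v)"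
      by (simp add: has_real_derivative_iff_has_vector_derivative)
  qed simp
  then have "integral {0..1} ?g = 1 * K (x * 1 powr s) - 0 * K (x * 0 powr s)"
    by (rule integral_unique)
  then have "integral {0..1} ?g = K x" by (simp only: powr_one_eq_one) simp
  moreover have "integral {0..1} ?g = (l - m) * coulomb_overlap \<eta> m l x"
    unfolding coulomb_overlap_def s_def by (rule integral_mult_right)
  ultimately show ?thesis by (simp add: K_def)
qed

lemma continuous_on_coulomb_overlap_integrand:
  assumes m: "m > -1/2"
  shows "continuous_on (({-1/2<..} \<times> UNIV) \<times> {0..1})
    (\<lambda>(p, v). coulomb_phi \<eta> (fst p) (snd p * v powr (1 / (fst p + m + 1)))
       * coulomb_phi \<eta> m (snd p * v powr (1 / (fst p + m + 1))))"
proof -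
  let ?D = "({-1/2<..} \<times> UNIV) \<times> {0..1} :: ((real \<times> real) \<times> real) set"
  have t: "continuous_on ?D (\<lambda>q. snd (fst q) * snd q powr (1 / (fst (fst q) + m + 1)))"
    using m by (intro continuous_intros continuous_on_powr') auto
  have "continuous_on ?D (\<lambda>q. (\<lambda>(l, x). coulomb_phi \<eta> l x) (fst (fst q), snd (fst q) * snd q powr (1 / (fst (fst q) + m + 1))))"
    by (rule continuous_on_compose2[OF continuous_on_coulomb_phi]) (intro continuous_intros t, auto)
  moreover have "continuous_on ?D (\<lambda>q. (\<lambda>(l, x). coulomb_phi \<eta> l x) (m, snd (fst q) * snd q powr (1 / (fst (fst q) + m + 1))))"
    by (rule continuous_on_compose2[OF continuous_on_coulomb_phi]) (intro continuous_intros t, use m in auto)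
  ultimately show ?thesis
    unfolding case_prod_unfold fst_conv snd_conv by (rule continuous_on_mult)
qed

lemma continuous_on_coulomb_overlap:
  assumes m: "m > -1/2"
  shows "continuous_on ({-1/2<..} \<times> UNIV) (\<lambda>(l, x). coulomb_overlap \<eta> m l x)"
  using integral_continuous_on_param[OF continuous_on_coulomb_overlap_integrand[OF m, folded cbox_interval], of \<eta>]
  unfolding coulomb_overlap_def case_prod_unfold cbox_interval .

text \<open>
  The integrand is a square that equals $1$ at $v = 0$.
\<close>

lemma coulomb_overlap_self_pos:
  assumes m: "m > -1/2"
  shows "coulomb_overlap \<eta> m m x > 0"
proof -
  let ?f = "\<lambda>v. coulomb_phi \<eta> m (x * v powr (1 / (m + m + 1))) * coulomb_phi \<eta> m (x * v powr (1 / (m + m + 1)))"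
  have cont: "continuous_on {0..1} ?f"
  proof -
    have t: "continuous_on {0..1} (\<lambda>v. x * v powr (1 / (m + m + 1)))"
      using m by (intro continuous_intros continuous_on_powr') auto
    have "continuous_on UNIV (coulomb_phi \<eta> m)"
      using isCont_coulomb_phi[OF m] by (simp add: continuous_at_imp_continuous_on)
    from continuous_on_compose2[OF this t] have "continuous_on {0..1} (\<lambda>v. coulomb_phi \<eta> m (x * v powr (1 / (m + m + 1))))"
      by simp
    then show ?thesis by (intro continuous_on_mult)
  qed
  have "integral {0..1} ?f \<ge> 0" by (rule integral_nonneg) (rule integrable_continuous_interval[OF cont], simp)
  moreover have "integral {0..1} ?f \<noteq> 0"
  proof
    assume "integral {0..1} ?f = 0"
    then have "\<forall>v\<in>{0..1}. ?f v = 0" using integral_eq_0_iff[OF cont] by simp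
    then have "?f 0 = 0" by (rule bspec) simp
    then show False by (simp add: coulomb_phi_0)
  qed
  ultimately show ?thesis by (simp add: coulomb_overlap_def)
qed

lemma tendsto_coulomb:
  assumes "(g \<longlongrightarrow> l) F" "(h \<longlongrightarrow> x) F" "l > -1/2" "m > -1/2"
  shows "((\<lambda>p. coulomb_overlap \<eta> m (g p) (h p)) \<longlongrightarrow> coulomb_overlap \<eta> m l x) F"
    and "((\<lambda>p. coulomb_dphi \<eta> (g p) (h p)) \<longlongrightarrow> coulomb_dphi \<eta> l x) F"
proof -
  have t: "((\<lambda>p. (g p, h p)) \<longlongrightarrow> (l, x)) F" by (intro tendsto_Pair assms)
  have ev: "\<forall>\<^sub>F p in F. (g p, h p) \<in> {-1/2<..} \<times> UNIV"
    using order_tendstoD(1)[OF assms(1,3)] by eventually_elim auto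
  have in_dom: "(l, x) \<in> {-1/2<..} \<times> UNIV" using assms by auto
  show "((\<lambda>p. coulomb_overlap \<eta> m (g p) (h p)) \<longlongrightarrow> coulomb_overlap \<eta> m l x) F"
    using continuous_on_tendsto_compose[OF continuous_on_coulomb_overlap[OF assms(4)] t in_dom ev] by simp
  show "((\<lambda>p. coulomb_dphi \<eta> (g p) (h p)) \<longlongrightarrow> coulomb_dphi \<eta> l x) F"
    using continuous_on_tendsto_compose[OF continuous_on_coulomb_dphi t in_dom ev] by simp
qed

text \<open>
  At a double zero of $\varphi_m$ the Wronskian identity forces $J(l,m,x) = 0$ for all $l$ different from $m$, hence also
  for $l = m$, which contradicts positivity.
\<close>

lemma coulomb_zeros_simple:
  assumes m: "m > -1/2" and zero: "coulomb_phi \<eta> m x = 0"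
  shows "coulomb_dphi \<eta> m x \<noteq> 0"
proof
  assume dzero: "coulomb_dphi \<eta> m x = 0"
  have "((\<lambda>l. coulomb_overlap \<eta> m l x) \<longlongrightarrow> coulomb_overlap \<eta> m m x) (at m)"
    using m by (intro tendsto_coulomb tendsto_intros) auto
  moreover have "\<forall>\<^sub>F l in at m. l > -1/2"
    using order_tendstoD(1)[OF tendsto_ident_at m] .
  then have "\<forall>\<^sub>F l in at m. coulomb_overlap \<eta> m l x = 0"
    using eventually_neq_at_within[of m] 
  proof eventually_elim
    case (elim l)
    with coulomb_wronskian[OF elim(1) m, of \<eta> x] zero dzero show ?case by simp
  qed
  then have "((\<lambda>l. coulomb_overlap \<eta> m l x) \<longlongrightarrow> 0) (at m)" by (rule tendsto_eventually)
  ultimately have "coulomb_overlap \<eta> m m x = 0" by (rule tendsto_unique[OF trivial_limit_at])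
  with coulomb_overlap_self_pos[OF m, of \<eta> x] show False by simp
qed

section \<open>Zeros of families of real functions\<close>

lemma eventually_nonzero_on_compact:
  fixes \<Psi> :: "'a::topological_space \<times> 'b::topological_space \<Rightarrow> real"
  assumes "continuous_on (S \<times> UNIV) \<Psi>" "open S" "m \<in> S" "compact K"
    and "\<And>x. x \<in> K \<Longrightarrow> \<Psi> (m, x) \<noteq> 0"
  shows "\<forall>\<^sub>F l in nhds m. \<forall>x\<in>K. \<Psi> (l, x) \<noteq> 0"
proof -
  have "open ((S \<times> UNIV) \<inter> \<Psi> -` (- {0}))"
    using assms by (intro continuous_open_preimage open_Times) auto
  moreover have "{m} \<times> K \<subseteq> (S \<times> UNIV) \<inter> \<Psi> -` (- {0})"
    using assms by auto
  ultimately obtain U where "m \<in> U" "open U" "U \<times> K \<subseteq> (S \<times> UNIV) \<inter> \<Psi> -` (- {0})"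
    using Elementary_Topology.tube_lemma[OF \<open>compact K\<close>] by metis
  then show ?thesis unfolding eventually_nhds by blast
qed

text \<open>
  An accumulation point of zeros would be a zero at which the difference quotients, and hence the derivative,
  vanish.
\<close>

lemma finite_simple_zeros:
  fixes f f' :: "real \<Rightarrow> real"
  assumes der: "\<And>x. (f has_real_derivative f' x) (at x)"
    and simple: "\<And>x. f x = 0 \<Longrightarrow> f' x \<noteq> 0"
  shows "finite {x \<in> {a..b}. f x = 0}"
proof (rule ccontr)
  assume "infinite {x \<in> {a..b}. f x = 0}"
  then obtain z where z: "z islimpt {x \<in> {a..b}. f x = 0}"
    using Heine_Borel_imp_Bolzano_Weierstrass[OF compact_Icc, of "{x \<in> {a..b}. f x = 0}" a b] by blast
  have cont: "(f \<longlongrightarrow> f z) (at z)"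
    using DERIV_isCont[OF der[of z]] by (simp add: isCont_def)
  have "\<forall>\<^sub>F x in at z. f x \<noteq> 0"
  proof (cases "f z = 0")
    case True
    have "((\<lambda>x. (f x - f z) / (x - z)) \<longlongrightarrow> f' z) (at z)"
      using der[of z] by (simp add: has_field_derivative_iff)
    from tendsto_imp_eventually_ne[OF this simple[OF True]]
    show ?thesis by eventually_elim (use True in auto)
  next
    case False
    then show ?thesis using tendsto_imp_eventually_ne[OF cont] by blast
  qed
  then have "\<forall>\<^sub>F x in at z. x \<notin> {x \<in> {a..b}. f x = 0}" by eventually_elim auto
  with z show False by (simp add: islimpt_iff_eventually)
qed

text \<open>
  Induction on the number of zeros in $[a,b]$. Around the last zero $z$ choose an interval $[c,d]$ on which
  $f_m'$ has constant sign. For $l$ near $m$ the function $f_l$ has no zero in $[d,b]$, exactly one in $[c,d]$ (it is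
  monotone there and changes sign), and the induction hypothesis applies to $[a,c]$. Finiteness is carried
  along in the induction, since a cardinality alone would not exclude an infinite set of zeros.
\<close>

lemma card_zeros_locally_constant:
  fixes f f' :: "real \<Rightarrow> real \<Rightarrow> real"
  assumes S: "open S" "m \<in> S"
    and cont: "continuous_on (S \<times> UNIV) (\<lambda>(l, x). f l x)" "continuous_on (S \<times> UNIV) (\<lambda>(l, x). f' l x)"
    and der: "\<And>l x. l \<in> S \<Longrightarrow> (f l has_real_derivative f' l x) (at x)"
    and simple: "\<And>x. f m x = 0 \<Longrightarrow> f' m x \<noteq> 0"
    and ends: "f m a \<noteq> 0" "f m b \<noteq> 0"
  shows "\<forall>\<^sub>F l in nhds m. card {x \<in> {a..b}. f l x = 0} = card {x \<in> {a..b}. f m x = 0}"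
proof -
  let ?Z = "\<lambda>l a b. {x \<in> {a..b}. f l x = 0}"
  have inS: "\<forall>\<^sub>F l in nhds m. l \<in> S" using S by (rule eventually_nhds_in_open)
  have nonzero: "\<forall>\<^sub>F l in nhds m. \<forall>x\<in>{u..v}. f l x \<noteq> 0"
    if "\<And>x. x \<in> {u..v} \<Longrightarrow> f m x \<noteq> 0" for u v
    using eventually_nonzero_on_compact[OF cont(1) S, of "{u..v}"] that by auto
  have nonzero': "\<forall>\<^sub>F l in nhds m. \<forall>x\<in>{u..v}. f' l x \<noteq> 0"
    if "\<And>x. x \<in> {u..v} \<Longrightarrow> f' m x \<noteq> 0" for u v
    using eventually_nonzero_on_compact[OF cont(2) S, of "{u..v}"] that by auto
  have cont_m: "continuous_on A (f l)" if "l \<in> S" for A l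
    using der[OF that] by (meson DERIV_isCont continuous_at_imp_continuous_on)
  have fin: "finite (?Z m u v)" for u v
    using finite_simple_zeros[OF der[OF S(2)] simple] .
  have main: "\<forall>\<^sub>F l in nhds m. finite (?Z l a b) \<and> card (?Z l a b) = card (?Z m a b)" 
    if "f m b \<noteq> 0" for b
    using that
  proof (induction "card (?Z m a b)" arbitrary: b rule: less_induct)
    case less
    show ?case
    proof (cases "?Z m a b = {}")
      case True
      then have "\<forall>\<^sub>F l in nhds m. \<forall>x\<in>{a..b}. f l x \<noteq> 0" by (intro nonzero) auto
      then show ?thesis
      proof eventually_elim
        case (elim l)
        then have empty: "?Z l a b = {}" by auto
        show ?case unfolding True empty by simp
      qed
    next
      case False
      define z where "z = Max (?Z m a b)"
      have "z \<in> ?Z m a b" unfolding z_def using fin False by (rule Max_in)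
      then have z: "f m z = 0" "a < z" "z < b"
        using ends(1) less.prems by (auto simp: order.strict_iff_order)
      have z_max: "x \<le> z" if "x \<in> ?Z m a b" for x unfolding z_def using fin that by (rule Max_ge)
      have "continuous_on UNIV (\<lambda>x. (\<lambda>(l, x). f' l x) (m, x))"
        by (rule continuous_on_compose2[OF cont(2)]) (use S in \<open>auto intro!: continuous_intros\<close>)
      then have "isCont (\<lambda>x. f' m x * f' m z) z"
        by (intro continuous_intros) (simp add: continuous_on_eq_continuous_at)
      moreover have "f' m z * f' m z > 0" using simple[OF z(1)] by (simp add: zero_less_mult_iff) linarith
      ultimately have "\<forall>\<^sub>F x in nhds z. f' m x * f' m z > 0"
        unfolding isCont_def tendsto_at_iff_tendsto_nhds[of "\<lambda>x. f' m x * f' m z"] by (rule order_tendstoD(1))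
      then obtain \<epsilon> where \<epsilon>: "\<epsilon> > 0" "\<And>x. dist x z < \<epsilon> \<Longrightarrow> f' m x * f' m z > 0"
        by (auto simp: eventually_nhds_metric)
      define \<delta> where "\<delta> = min (\<epsilon> / 2) (min (z - a) (b - z))"
      define c where "c = z - \<delta>"
      define d where "d = z + \<delta>"
      have \<delta>: "\<delta> > 0" "\<delta> < \<epsilon>" "a \<le> c" "c < z" "z < d" "d \<le> b"
        using \<epsilon>(1) z by (auto simp: \<delta>_def c_def d_def min_def)
      have f'_sign: "f' m x * f' m z > 0" if "x \<in> {c..d}" for x
        using that \<delta> by (intro \<epsilon>(2)) (auto simp: c_def d_def dist_real_def abs_if)
      have sign_c: "f m c * f' m z < 0"
      proof -
        obtain \<xi> where \<xi>: "c < \<xi>" "\<xi> < z" "f m z - f m c = (z - c) * f' m \<xi>"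
          using MVT2[OF \<open>c < z\<close>, of "f m" "f' m"] der[OF S(2)] by blast
        have "f m c = - ((z - c) * f' m \<xi>)" using \<xi>(3) z(1) by linarith
        then have "f m c * f' m z = - ((z - c) * (f' m \<xi> * f' m z))" by simp
        moreover have "(z - c) * (f' m \<xi> * f' m z) > 0"
          using f'_sign[of \<xi>] \<xi> \<delta> by (intro mult_pos_pos[of _ "_ * _"]) auto
        ultimately show ?thesis by linarith
      qed
      have sign_d: "f m d * f' m z > 0"
      proof -
        obtain \<xi> where \<xi>: "z < \<xi>" "\<xi> < d" "f m d - f m z = (d - z) * f' m \<xi>"
          using MVT2[OF \<open>z < d\<close>, of "f m" "f' m"] der[OF S(2)] by blast
        have "f m d * f' m z = (d - z) * (f' m \<xi> * f' m z)"
          using \<xi>(3) z(1) by simp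
        moreover have "(d - z) * (f' m \<xi> * f' m z) > 0"
          using f'_sign[of \<xi>] \<xi> \<delta> by (intro mult_pos_pos[of _ "_ * _"]) auto
        ultimately show ?thesis by linarith
      qed
      have c_nz: "f m c \<noteq> 0" and d_nz: "f m d \<noteq> 0" using sign_c sign_d by auto
      have tail_m: "f m x \<noteq> 0" if "x \<in> {d..b}" for x
        using z_max[of x] that \<delta> z by auto
      have mid_unique: "?Z m c d = {z}"
      proof (intro equalityI subsetI)
        fix x assume x: "x \<in> ?Z m c d"
        show "x \<in> {z}"
        proof (rule ccontr)
          assume "x \<notin> {z}"
          with x z_max[of x] \<delta> have "x < z" by auto
          then obtain \<xi> where "x < \<xi>" "\<xi> < z" "f m z - f m x = (z - x) * f' m \<xi>"
            using MVT2[OF \<open>x < z\<close>, of "f m" "f' m"] der[OF S(2)] by blast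
          with f'_sign[of \<xi>] x z \<delta> show False by auto
        qed
      qed (use z \<delta> in auto)
      have split: "?Z l a b = ?Z l a c \<union> ?Z l c d \<union> ?Z l d b" for l using \<delta> by auto
      have card_split: "card (?Z l a b) = card (?Z l a c) + card (?Z l c d)"
        if "f l c \<noteq> 0" "\<forall>x\<in>{d..b}. f l x \<noteq> 0" "finite (?Z l a c)" "finite (?Z l c d)" for l
      proof -
        have "?Z l d b = {}" using that(2) by blast
        then have "card (?Z l a b) = card (?Z l a c \<union> ?Z l c d)" by (simp only: split) simp
        also have "\<dots> = card (?Z l a c) + card (?Z l c d)"
          using that by (intro card_Un_disjoint) (auto intro: antisym)
        finally show ?thesis .
      qed
      have card_m: "card (?Z m a b) = card (?Z m a c) + 1"
        using card_split[of m] c_nz tail_m fin mid_unique by simp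
      have "\<forall>\<^sub>F l in nhds m. finite (?Z l a c) \<and> card (?Z l a c) = card (?Z m a c)"
        using card_m c_nz by (intro less.hyps) auto
      moreover have "\<forall>\<^sub>F l in nhds m. \<forall>x\<in>{d..b}. f l x \<noteq> 0"
        using tail_m by (rule nonzero)
      moreover have "\<forall>\<^sub>F l in nhds m. \<forall>x\<in>{c..d}. f' l x \<noteq> 0"
        using f'_sign by (intro nonzero') force
      moreover have "\<forall>\<^sub>F l in nhds m. f l c * f l d < 0"
      proof -
        have "((\<lambda>l. (\<lambda>(l, x). f l x) (l, x)) \<longlongrightarrow> (\<lambda>(l, x). f l x) (m, x)) (nhds m)" for x
          by (rule continuous_on_tendsto_compose[OF cont(1)])
             (use S inS in \<open>auto intro!: tendsto_intros filterlim_ident\<close>)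
        then have "((\<lambda>l. f l c * f l d) \<longlongrightarrow> f m c * f m d) (nhds m)"
          by (intro tendsto_mult) auto
        moreover have "f m c * f m d < 0"
          using sign_c sign_d by (auto simp: mult_less_0_iff zero_less_mult_iff)
        ultimately show ?thesis by (rule order_tendstoD(2))
      qed
      ultimately show ?thesis using inS
      proof eventually_elim
        case (elim l)
        have "\<exists>w. ?Z l c d = {w}"
        proof -
          obtain w where w: "c \<le> w" "w \<le> d" "f l w = 0"
          proof (cases "f l c < 0")
            case True
            with elim(4) have "f l d > 0" by (auto simp: mult_less_0_iff)
            with True show ?thesis using IVT'[of "f l" c 0 d] cont_m[OF elim(5)] \<delta> that by force
          next
            case False
            with elim(4) have "f l c > 0" "f l d < 0" by (auto simp: mult_less_0_iff)
            then show ?thesis using IVT2'[of "f l" d 0 c] cont_m[OF elim(5)] \<delta> that by force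
          qed
          have no_pair: False if "x < y" "x \<in> ?Z l c d" "y \<in> ?Z l c d" for x y
          proof -
            obtain \<xi> where "x < \<xi>" "\<xi> < y" "f l y - f l x = (y - x) * f' l \<xi>"
              using MVT2[OF \<open>x < y\<close>, of "f l" "f' l"] der[OF elim(5)] by blast
            with that elim(3) show False by auto
          qed
          have "?Z l c d = {w}"
            using w no_pair[of w] no_pair[of _ w] by (auto simp: set_eq_iff) (metis linorder_neqE)
          then show ?thesis ..
        qed
        then obtain w where w: "?Z l c d = {w}" ..
        have "finite (?Z l a b)"
        proof -
          have "?Z l d b = {}" using elim(2) by blast
          with elim(1) w show ?thesis by (simp only: split) simp
        qed
        moreover have "card (?Z l a b) = card (?Z m a b)"
        proof -
          have "f l c \<noteq> 0" using elim(4) by auto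
          then show ?thesis using card_split[of l] elim(1,2) w card_m by simp
        qed
        ultimately show ?case ..
      qed
    qed
  qed
  show ?thesis using main[OF ends(2)] by eventually_elim simp
qed

lemma kth_element_exists_unique:
  fixes Z :: "real set"
  assumes fin: "\<And>x. finite {y \<in> Z. y \<le> x}" and unbounded: "\<And>x. \<exists>y\<in>Z. x < y" and "k \<ge> 1"
  shows "\<exists>!x. x \<in> Z \<and> card {y \<in> Z. y \<le> x} = k"
proof (rule ex_ex1I)
  show "\<exists>x. x \<in> Z \<and> card {y \<in> Z. y \<le> x} = k"
    using \<open>k \<ge> 1\<close>
  proof (induction k rule: nat_induct_at_least)
    have step: "\<exists>x\<in>Z. x0 < x \<and> {y \<in> Z. y \<le> x} = insert x {y \<in> Z. y \<le> x0}" for x0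
    proof -
      obtain w where w: "w \<in> Z" "x0 < w" using unbounded by blast
      define A where "A = {y \<in> Z. x0 < y \<and> y \<le> w}"
      have A: "finite A" "A \<noteq> {}" unfolding A_def using w
        by (auto intro: finite_subset[OF _ fin[of w]])
      have "Min A \<in> A" using A by (rule Min_in)
      moreover have "y = Min A" if "y \<in> Z" "x0 < y" "y \<le> Min A" for y
        using that Min_le[OF A(1), of y] \<open>Min A \<in> A\<close> by (force simp: A_def)
      ultimately have "Min A \<in> Z \<and> x0 < Min A \<and> {y \<in> Z. y \<le> Min A} = insert (Min A) {y \<in> Z. y \<le> x0}"
        unfolding A_def by fastforce
      then show ?thesis by blast
    qed
    {
      case base
      obtain z where z: "z \<in> Z" using unbounded by blast
      define x0 where "x0 = Min {y \<in> Z. y \<le> z}"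
      have x0: "x0 \<in> Z" "x0 \<le> z"
        using Min_in[OF fin[of z]] z unfolding x0_def by auto
      have "y = x0" if "y \<in> Z" "y \<le> x0" for y
        using that Min_le[OF fin[of z], of y] x0 unfolding x0_def[symmetric] by force
      then have "{y \<in> Z. y \<le> x0} = {x0}" using x0 by auto
      with x0 show ?case by auto
    next
      case (Suc n)
      then obtain x0 where x0: "x0 \<in> Z" "card {y \<in> Z. y \<le> x0} = n" by blast
      obtain x where "x \<in> Z" "x0 < x" "{y \<in> Z. y \<le> x} = insert x {y \<in> Z. y \<le> x0}"
        using step by blast
      with x0 fin[of x0] show ?case by (intro exI[of _ x]) auto
    }
  qed
next
  fix x y assume *: "x \<in> Z \<and> card {z \<in> Z. z \<le> x} = k" "y \<in> Z \<and> card {z \<in> Z. z \<le> y} = k"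
  have False if "u < v" "v \<in> Z" "card {z \<in> Z. z \<le> u} = card {z \<in> Z. z \<le> v}" for u v
  proof -
    have "{z \<in> Z. z \<le> u} \<subset> {z \<in> Z. z \<le> v}" using that by force
    from psubset_card_mono[OF fin this] that show False by simp
  qed
  with * show "x = y" by (metis linorder_neqE)
qed

section \<open>Oscillation\<close>

text \<open>
  Sturm comparison. The function $y = x^{l+1} \varphi_l$ satisfies $y'' = - q y$ with $q(x) \rightarrow 1$, so $q > 1/4$
  from some $A$ on. If $y$ had constant sign, say $y > 0$, beyond $A$, then its Wronskian
  with $\sin((x-A)/2)$ would be nonincreasing on one half-period $[A, A + 2\pi]$, but it goes from the negative value
  $-y(A)/2$ to the positive value $y(A+2\pi)/2$.
\<close>

lemma coulomb_phi_unbounded_zeros: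
  assumes l: "l > -1/2"
  shows "\<exists>x>a. coulomb_phi \<eta> l x = 0"
proof -
  define q where "q = (\<lambda>x. 1 - 2 * \<eta> / x - l * (l + 1) / x\<^sup>2)"
  have "(q \<longlongrightarrow> 1 - 0 - 0) at_top"
    unfolding q_def
    by (intro tendsto_intros tendsto_divide_0[OF tendsto_const] filterlim_at_top_imp_at_infinity filterlim_ident
          filterlim_pow_at_top) auto
  then have "\<forall>\<^sub>F x in at_top. q x > 1/4" by (rule order_tendstoD) simp
  then obtain A0 where A0: "\<And>x. x \<ge> A0 \<Longrightarrow> q x > 1/4" by (auto simp: eventually_at_top_linorder)
  \<comment> \<open>Beyond $a$ and $0$, and where $q > 1/4$.\<close>
  define A where "A = max (max A0 (a + 1)) 1"
  have A: "A > 0" "A > a" "\<And>x. x \<ge> A \<Longrightarrow> q x > 1/4" using A0 by (auto simp: A_def)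
  define B where "B = A + 2 * pi"
  have "A \<le> B" by (simp add: B_def)
  show ?thesis
  proof (rule ccontr)
    assume none: "\<not> ?thesis"
    have nz: "coulomb_phi \<eta> l x \<noteq> 0" if "x \<ge> A" for x
      using none that A(2) by force
    define s where "s = sgn (coulomb_phi \<eta> l A)"
    have pos: "s * coulomb_phi \<eta> l x > 0" if "x \<ge> A" for x
    proof -
      have cont: "continuous_on {A..x} (coulomb_phi \<eta> l)"
        by (intro continuous_at_imp_continuous_on ballI isCont_coulomb_phi l)
      consider "coulomb_phi \<eta> l A > 0" | "coulomb_phi \<eta> l A < 0" using nz[of A] by force
      then show ?thesis
      proof cases
        case 1
        have "\<not> coulomb_phi \<eta> l x \<le> 0"
          using IVT2'[of "coulomb_phi \<eta> l" x 0 A] 1 that cont nz by force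
        with 1 show ?thesis by (simp add: s_def)
      next
        case 2
        have "\<not> coulomb_phi \<eta> l x \<ge> 0"
          using IVT'[of "coulomb_phi \<eta> l" A 0 x] 2 that cont nz by force
        with 2 show ?thesis by (simp add: s_def)
      qed
    qed
    \<comment> \<open>The solution $x^{l+1} \varphi_l(x)$, with the sign that makes it positive on $[A,\infty)$.\<close>
    define y where "y = (\<lambda>x. s * (x powr l * (x * coulomb_phi \<eta> l x)))"
    define y' where "y' = (\<lambda>x. s * (x powr l * ((l + 1) * coulomb_phi \<eta> l x + x * coulomb_dphi \<eta> l x)))"
    have y_pos: "y x > 0" if "x \<ge> A" for x
    proof -
      have "y x = (x powr l * x) * (s * coulomb_phi \<eta> l x)" by (simp add: y_def)
      also have "\<dots> > 0" using pos[OF that] that A(1) by (intro mult_pos_pos[of "_ powr _ * _"]) auto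
      finally show ?thesis .
    qed
    have dy: "(y has_real_derivative y' x) (at x)" if "x > 0" for x
    proof -
      have u: "x powr l = x powr (l - 1) * x" using that by (simp add: powr_diff)
      show ?thesis unfolding y_def y'_def
        by (rule derivative_eq_intros has_real_derivative_powr l that refl)+ (simp add: u algebra_simps)
    qed
    have dy': "(y' has_real_derivative - q x * y x) (at x)" if "x > 0" for x
    proof -
      have u: "x powr l = x powr (l - 1) * x" using that by (simp add: powr_diff)
      obtain d where d: "(coulomb_dphi \<eta> l has_real_derivative d) (at x)"
        and ode: "x * d + 2 * (l + 1) * coulomb_dphi \<eta> l x + (x - 2 * \<eta>) * coulomb_phi \<eta> l x = 0"
        using coulomb_ode[OF l] by blast
      have xd: "x * d = - (2 * (l + 1) * coulomb_dphi \<eta> l x + (x - 2 * \<eta>) * coulomb_phi \<eta> l x)"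
        using ode by linarith
      have "(y' has_real_derivative s * (x powr (l - 1) * (l * ((l + 1) * coulomb_phi \<eta> l x + x * coulomb_dphi \<eta> l x)
            + x * ((l + 2) * coulomb_dphi \<eta> l x + x * d)))) (at x)"
        unfolding y'_def
        by (rule derivative_eq_intros has_real_derivative_powr d l that refl)+ (simp add: u algebra_simps)
      also have "l * ((l + 1) * coulomb_phi \<eta> l x + x * coulomb_dphi \<eta> l x)
            + x * ((l + 2) * coulomb_dphi \<eta> l x + x * d) = - q x * x\<^sup>2 * coulomb_phi \<eta> l x"
        unfolding xd q_def using that by (simp add: field_simps power2_eq_square)
      finally show ?thesis by (simp add: y_def u power2_eq_square mult_ac)
    qed
    define W where "W = (\<lambda>x. y' x * sin ((x - A) / 2) - y x * (cos ((x - A) / 2) / 2))"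
    have "W B \<le> W A"
    proof (rule DERIV_nonpos_imp_nonincreasing[OF \<open>A \<le> B\<close>])
      fix x assume x: "A \<le> x" "x \<le> B"
      then have "x > 0" using A(1) by simp
      have "(W has_real_derivative (1/4 - q x) * (y x * sin ((x - A) / 2))) (at x)"
        unfolding W_def
        by (rule derivative_eq_intros dy dy' \<open>x > 0\<close> refl | simp)+ (simp add: algebra_simps)
      moreover have "(1/4 - q x) * (y x * sin ((x - A) / 2)) \<le> 0"
      proof (rule mult_nonpos_nonneg)
        have "sin ((x - A) / 2) \<ge> 0" using x by (intro sin_ge_zero) (auto simp: B_def)
        then show "y x * sin ((x - A) / 2) \<ge> 0" using y_pos[OF x(1)] by simp
      qed (use A(3)[OF x(1)] in simp)
      ultimately show "\<exists>d. (W has_real_derivative d) (at x) \<and> d \<le> 0" by blast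
    qed
    moreover have "W A = - y A / 2" "W B = y B / 2" by (simp_all add: W_def B_def)
    ultimately show False using y_pos[of A] y_pos[of B] \<open>A \<le> B\<close> by simp
  qed
qed

section \<open>The zeros as functions of the parameter\<close>

lemma coulomb_zero_set:
  assumes l: "l > -1/2"
  shows "{y. 0 < y \<and> y \<le> x \<and> coulomb_F l \<eta> y = 0} = {y \<in> {0..x}. coulomb_phi \<eta> l y = 0}"
proof (intro set_eqI)
  fix y
  have "coulomb_phi \<eta> l y \<noteq> 0" if "y = 0" using that by (simp add: coulomb_phi_0)
  then show "y \<in> {y. 0 < y \<and> y \<le> x \<and> coulomb_F l \<eta> y = 0} \<longleftrightarrow> y \<in> {y \<in> {0..x}. coulomb_phi \<eta> l y = 0}"
    using coulomb_F_eq_0_iff[OF l, of y \<eta>] by (cases "y = 0") auto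
qed

lemma finite_coulomb_zeros:
  assumes l: "l > -1/2"
  shows "finite {y \<in> {0..x}. coulomb_phi \<eta> l y = 0}"
proof (rule finite_simple_zeros)
  show "(coulomb_phi \<eta> l has_real_derivative coulomb_dphi \<eta> l y) (at y)" for y
    using has_real_derivative_coulomb_phi[OF DERIV_ident l, of \<eta> y] by simp
qed (rule coulomb_zeros_simple[OF l])

lemma coulomb_zero:
  assumes l: "l > -1/2" and k: "k \<ge> 1"
  shows coulomb_zero_pos: "coulomb_zero l \<eta> k > 0"
    and coulomb_phi_coulomb_zero: "coulomb_phi \<eta> l (coulomb_zero l \<eta> k) = 0"
    and card_coulomb_zeros: "card {y \<in> {0..coulomb_zero l \<eta> k}. coulomb_phi \<eta> l y = 0} = k"
proof -
  let ?P = "\<lambda>x. 0 < x \<and> coulomb_F l \<eta> x = 0 \<and> card {y. 0 < y \<and> y \<le> x \<and> coulomb_F l \<eta> y = 0} = k"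
  define Z where "Z = {y. 0 < y \<and> coulomb_F l \<eta> y = 0}"
  have Z_le: "{y \<in> Z. y \<le> x} = {y. 0 < y \<and> y \<le> x \<and> coulomb_F l \<eta> y = 0}" for x
    by (auto simp: Z_def)
  have "\<exists>!x. x \<in> Z \<and> card {y \<in> Z. y \<le> x} = k"
  proof (rule kth_element_exists_unique[OF _ _ k])
    show "finite {y \<in> Z. y \<le> x}" for x
      unfolding Z_le coulomb_zero_set[OF l] by (rule finite_coulomb_zeros[OF l])
    show "\<exists>y\<in>Z. x < y" for x
      using coulomb_phi_unbounded_zeros[OF l, of "max x 0" \<eta>] by (auto simp: Z_def coulomb_F_eq_0_iff[OF l])
  qed
  then have "\<exists>!x. ?P x" unfolding Z_le by (simp add: Z_def conj_assoc)
  from theI'[OF this] have P: "?P (coulomb_zero l \<eta> k)" unfolding coulomb_zero_def .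
  then show "coulomb_zero l \<eta> k > 0" "coulomb_phi \<eta> l (coulomb_zero l \<eta> k) = 0"
    "card {y \<in> {0..coulomb_zero l \<eta> k}. coulomb_phi \<eta> l y = 0} = k"
    using coulomb_F_eq_0_iff[OF l, of "coulomb_zero l \<eta> k" \<eta>] by (simp_all add: coulomb_zero_set[OF l])
qed

text \<open>
  This translates statements about the position of the $k$-th zero into statements about the number of
  zeros, which is locally constant in $l$.
\<close>

lemma coulomb_zero_le_iff:
  assumes l: "l > -1/2" and k: "k \<ge> 1"
  shows "coulomb_zero l \<eta> k \<le> x \<longleftrightarrow> k \<le> card {y \<in> {0..x}. coulomb_phi \<eta> l y = 0}"
proof
  assume "coulomb_zero l \<eta> k \<le> x"
  then have "card {y \<in> {0..coulomb_zero l \<eta> k}. coulomb_phi \<eta> l y = 0} \<le> card {y \<in> {0..x}. coulomb_phi \<eta> l y = 0}"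
    by (intro card_mono finite_coulomb_zeros[OF l]) auto
  then show "k \<le> card {y \<in> {0..x}. coulomb_phi \<eta> l y = 0}"
    by (simp only: card_coulomb_zeros[OF l k])
next
  assume *: "k \<le> card {y \<in> {0..x}. coulomb_phi \<eta> l y = 0}"
  show "coulomb_zero l \<eta> k \<le> x"
  proof (rule ccontr)
    assume "\<not> coulomb_zero l \<eta> k \<le> x"
    then have "coulomb_zero l \<eta> k \<in> {y \<in> {0..coulomb_zero l \<eta> k}. coulomb_phi \<eta> l y = 0}
      - {y \<in> {0..x}. coulomb_phi \<eta> l y = 0}"
      using coulomb_zero_pos[OF l k, of \<eta>] coulomb_phi_coulomb_zero[OF l k, of \<eta>] by auto
    moreover have "{y \<in> {0..x}. coulomb_phi \<eta> l y = 0} \<subseteq> {y \<in> {0..coulomb_zero l \<eta> k}. coulomb_phi \<eta> l y = 0}"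
      using \<open>\<not> coulomb_zero l \<eta> k \<le> x\<close> by auto
    ultimately have "{y \<in> {0..x}. coulomb_phi \<eta> l y = 0} \<subset> {y \<in> {0..coulomb_zero l \<eta> k}. coulomb_phi \<eta> l y = 0}"
      by blast
    from psubset_card_mono[OF finite_coulomb_zeros[OF l] this] * show False
      by (simp only: card_coulomb_zeros[OF l k])
  qed
qed

lemma eventually_coulomb_zero_le_iff:
  assumes m: "m > -1/2" and k: "k \<ge> 1" and x: "coulomb_phi \<eta> m x \<noteq> 0"
  shows "\<forall>\<^sub>F l in nhds m. coulomb_zero l \<eta> k \<le> x \<longleftrightarrow> coulomb_zero m \<eta> k \<le> x"
proof -
  have "\<forall>\<^sub>F l in nhds m. card {y \<in> {0..x}. coulomb_phi \<eta> l y = 0} = card {y \<in> {0..x}. coulomb_phi \<eta> m y = 0}"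
  proof (rule card_zeros_locally_constant[where S = "{-1/2<..}" and f' = "coulomb_dphi \<eta>"])
    show "(coulomb_phi \<eta> l has_real_derivative coulomb_dphi \<eta> l x) (at x)" if "l \<in> {-1/2<..}" for l x
      using has_real_derivative_coulomb_phi[OF DERIV_ident, of l \<eta> x] that by simp
  qed (use m x continuous_on_coulomb_phi continuous_on_coulomb_dphi coulomb_zeros_simple in
      \<open>auto simp: coulomb_phi_0\<close>)
  moreover have "\<forall>\<^sub>F l in nhds m. l \<in> {-1/2<..}"
    using m by (intro eventually_nhds_in_open) auto
  ultimately show ?thesis
  proof eventually_elim
    case (elim l)
    then have "l > -1/2" by simp
    show ?case unfolding coulomb_zero_le_iff[OF \<open>l > -1/2\<close> k] coulomb_zero_le_iff[OF m k] elim(1) by (rule refl)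
  qed
qed

lemma coulomb_phi_nonzero_dense:
  assumes l: "l > -1/2" and "0 \<le> a" "a < b"
  shows "\<exists>x. a < x \<and> x < b \<and> coulomb_phi \<eta> l x \<noteq> 0"
proof (rule ccontr)
  assume "\<not> ?thesis"
  then have "{a<..<b} \<subseteq> {y \<in> {0..b}. coulomb_phi \<eta> l y = 0}" using \<open>0 \<le> a\<close> by auto
  from finite_subset[OF this finite_coulomb_zeros[OF l]] infinite_Ioo[OF \<open>a < b\<close>] show False by blast
qed

lemma tendsto_coulomb_zero:
  assumes m: "m > -1/2" and k: "k \<ge> 1"
  shows "((\<lambda>l. coulomb_zero l \<eta> k) \<longlongrightarrow> coulomb_zero m \<eta> k) (nhds m)"
proof (rule order_tendstoI)
  let ?r = "coulomb_zero m \<eta> k"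
  have r: "?r > 0" by (rule coulomb_zero_pos[OF m k])
  fix a assume "a < ?r"
  with r obtain x where x: "max a 0 < x" "x < ?r" "coulomb_phi \<eta> m x \<noteq> 0"
    using coulomb_phi_nonzero_dense[OF m, of "max a 0" ?r] by auto
  from eventually_coulomb_zero_le_iff[OF m k x(3)]
  show "\<forall>\<^sub>F l in nhds m. a < coulomb_zero l \<eta> k"
    by eventually_elim (use x in auto)
next
  let ?r = "coulomb_zero m \<eta> k"
  have r: "?r > 0" by (rule coulomb_zero_pos[OF m k])
  fix b assume "?r < b"
  with r obtain x where x: "?r < x" "x < b" "coulomb_phi \<eta> m x \<noteq> 0"
    using coulomb_phi_nonzero_dense[OF m, of ?r b] by auto
  from eventually_coulomb_zero_le_iff[OF m k x(3)]
  show "\<forall>\<^sub>F l in nhds m. coulomb_zero l \<eta> k < b"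
    by eventually_elim (use x in auto)
qed

text \<open>
  Caratheodory's form $\varphi_m(z) - \varphi_m(r) = g(z) (z - r)$ of the derivative turns the Wronskian identity
  at the zero $\rho(l)$ of $\varphi_l$ into the exact formula
  $(\rho(l) - r) / (l - m) = J(l,m,\rho(l)) / (\rho(l) \varphi_l'(\rho(l)) g(\rho(l)))$, where every term on the right is
  continuous at $l = m$.
\<close>

lemma has_real_derivative_coulomb_zero:
  fixes \<eta> m :: real and k :: nat
  assumes m: "m > -1/2" and k: "k \<ge> 1"
  defines "r \<equiv> coulomb_zero m \<eta> k"
  shows "((\<lambda>l. coulomb_zero l \<eta> k) has_real_derivative
            coulomb_overlap \<eta> m m r / (r * (coulomb_dphi \<eta> m r)\<^sup>2)) (at m)"
proof -
  let ?z = "\<lambda>l. coulomb_zero l \<eta> k"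
  have r: "r > 0" "coulomb_phi \<eta> m r = 0"
    unfolding r_def using coulomb_zero_pos[OF m k] coulomb_phi_coulomb_zero[OF m k] by auto
  have dr: "coulomb_dphi \<eta> m r \<noteq> 0" by (rule coulomb_zeros_simple[OF m r(2)])
  obtain g where g: "\<And>z. coulomb_phi \<eta> m z - coulomb_phi \<eta> m r = g z * (z - r)"
    and g_cont: "isCont g r" and g_r: "g r = coulomb_dphi \<eta> m r"
    using has_real_derivative_coulomb_phi[OF DERIV_ident m, of \<eta> r UNIV]
    unfolding CARAT_DERIV by auto
  have z: "(?z \<longlongrightarrow> r) (at m)"
    unfolding r_def by (rule filterlim_mono[OF tendsto_coulomb_zero[OF m k] order_refl]) (simp add: at_within_le_nhds)
  have l: "((\<lambda>l. l) \<longlongrightarrow> m) (at m)" by (rule tendsto_ident_at)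
  define q where "q = (\<lambda>l. ?z l * coulomb_dphi \<eta> l (?z l) * g (?z l))"
  have q: "(q \<longlongrightarrow> r * coulomb_dphi \<eta> m r * coulomb_dphi \<eta> m r) (at m)"
    unfolding q_def using isCont_tendsto_compose[OF g_cont z] g_r
    by (intro tendsto_mult z tendsto_coulomb(2)[OF l z m m]) simp
  have lim_nz: "r * coulomb_dphi \<eta> m r * coulomb_dphi \<eta> m r \<noteq> 0" using r dr by simp
  have "((\<lambda>l. coulomb_overlap \<eta> m l (?z l) / q l) \<longlongrightarrow>
      coulomb_overlap \<eta> m m r / (r * coulomb_dphi \<eta> m r * coulomb_dphi \<eta> m r)) (at m)"
    by (intro tendsto_divide tendsto_coulomb(1)[OF l z m m] q lim_nz)
  moreover have "\<forall>\<^sub>F l in at m. coulomb_overlap \<eta> m l (?z l) / q l = (?z l - ?z m) / (l - m)"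
    using order_tendstoD(1)[OF l m] eventually_neq_at_within[of m] tendsto_imp_eventually_ne[OF q lim_nz]
  proof eventually_elim
    case (elim l)
    have "coulomb_phi \<eta> m (?z l) = g (?z l) * (?z l - r)" using g[of "?z l"] r(2) by simp
    with coulomb_wronskian[OF elim(1) m, of \<eta> "?z l"] coulomb_phi_coulomb_zero[OF elim(1) k, of \<eta>]
    have "q l * (?z l - r) = (l - m) * coulomb_overlap \<eta> m l (?z l)"
      by (simp add: q_def mult_ac)
    with elim(2,3) show ?case by (simp add: r_def field_simps)
  qed
  ultimately have "((\<lambda>l. (?z l - ?z m) / (l - m)) \<longlongrightarrow>
      coulomb_overlap \<eta> m m r / (r * coulomb_dphi \<eta> m r * coulomb_dphi \<eta> m r)) (at m)"
    by (rule Lim_transform_eventually)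
  then show ?thesis by (simp add: has_field_derivative_iff power2_eq_square mult.assoc)
qed

theorem theorem4p1:
  fixes k :: nat and \<eta> :: real
  assumes "k \<ge> 1"
  shows "strict_mono_on {-1/2<..} (\<lambda>l. coulomb_zero l \<eta> k) \<and>
         (\<forall>l>-1/2. \<exists>D>0. ((\<lambda>l. coulomb_zero l \<eta> k) has_real_derivative D) (at l))"
proof
  show deriv: "\<forall>l>-1/2. \<exists>D>0. ((\<lambda>l. coulomb_zero l \<eta> k) has_real_derivative D) (at l)"
  proof (intro allI impI)
    fix l :: real assume l: "l > -1/2"
    let ?r = "coulomb_zero l \<eta> k"
    have "coulomb_overlap \<eta> l l ?r / (?r * (coulomb_dphi \<eta> l ?r)\<^sup>2) > 0"
      using coulomb_overlap_self_pos[OF l] coulomb_zero_pos[OF l assms]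
        coulomb_zeros_simple[OF l coulomb_phi_coulomb_zero[OF l assms]] by simp
    with has_real_derivative_coulomb_zero[OF l assms]
    show "\<exists>D>0. ((\<lambda>l. coulomb_zero l \<eta> k) has_real_derivative D) (at l)"
      by (intro exI conjI)
  qed
  show "strict_mono_on {-1/2<..} (\<lambda>l. coulomb_zero l \<eta> k)"
  proof (rule strict_mono_onI)
    fix a b :: real assume a: "a \<in> {-1/2<..}" and "a < b"
    show "coulomb_zero a \<eta> k < coulomb_zero b \<eta> k"
    proof (rule DERIV_pos_imp_increasing[OF \<open>a < b\<close>])
      fix l assume "a \<le> l" "l \<le> b"
      with a have "l > -1/2" by simp
      with deriv obtain D where "D > 0" "((\<lambda>l. coulomb_zero l \<eta> k) has_real_derivative D) (at l)"
        by (elim allE[of _ l] impE exE conjE)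
      then show "\<exists>D. ((\<lambda>l. coulomb_zero l \<eta> k) has_real_derivative D) (at l) \<and> D > 0"
        by (intro exI conjI)
    qed
  qed
qed

end
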